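(* Let $n,k\ge 1$, let $A=\mathbb{C}[\sigma_1,\sigma_1^{-1},\ldots,\sigma_n,\sigma_n^{-1}]$, and let $G$ be a finite subgroup of the group $\mathrm{Aut}_{\mathbb{C}}(A)$ of $\mathbb{C}$-algebra automorphisms of $A$. Let $P$ be a proper $A$-submodule of $A^k$ which is invariant under the componentwise action of $G$ on $A^k$ (i.e. $g(P)=P$ for all $g\in G$). Then there are nontrivial (i.e. nonzero) symmetric solutions to the system of difference equations defined by $P$, that is, $\ker_{\mathcal{F}}(P)^G\neq 0$.
   Context: $\mathbb{L}=\mathbb{Z}^n$ and $\mathcal{F}=\mathbb{C}^{\mathbb{Z}^n}$ is the space of all complex-valued functions on $\mathbb{L}$. The Laurent polynomial ring $A$ is the ring of partial difference operators: $\sigma_i$ acts on $f\in\mathcal{F}$ by $(\sigma_i f)(x_1,\ldots,x_n)=f(x_1,\ldots,x_i+1,\ldots,x_n)$, which makes $\mathcal{F}$ an $A$-module. For an $A$-submodule $P\subset A^k$, the solution space of the system defined by $P$ is $\ker_{\mathcal{F}}(P)=\{(f_1,\ldots,f_k)\in\mathcal{F}^k : \sum_j p_jf_j=0 \text{ for all } (p_1,\ldots,p_k)\in P\}$. Identify $x\in\mathbb{L}$ with the monomial $\sigma^x=\sigma_1^{x_1}\cdots\sigma_n^{x_n}$. These monomials form a $\mathbb{C}$-basis of $A$, so $\mathcal{F}$ is identified with the dual $A'=\mathrm{Hom}_{\mathbb{C}}(A,\mathbb{C})$ by linear extension, and $\ker_{\mathcal{F}}(P)$ is identified with $(A^k/P)'=\mathrm{Hom}_{\mathbb{C}}(A^k/P,\mathbb{C})$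 via $(f_1,\ldots,f_k)\mapsto\big([(q_1,\ldots,q_k)]\mapsto \sum_j f_j(q_j)\big)$. $G$ acts on $A$ by automorphisms, on $A^k$ componentwise, on $A^k/P$ when $P$ is $G$-invariant, and on the dual spaces by $(g\cdot f)(a)=f(g^{-1}a)$. The symmetric (or $G$-invariant) solutions are the elements of the fixed subspace $\ker_{\mathcal{F}}(P)^G$. *)

theory Defs
  imports "HOL-Analysis.Finite_Cartesian_Product" "HOL-Library.Poly_Mapping"
    "HOL-Library.Function_Algebras" "HOL-Algebra.Group"
begin

text \<open>The ring A of Laurent polynomials in n variables is the group ring of the exponent lattice:
  finitely supported functions from \<open>int ^ 'n\<close> to the complex numbers with convolution as product.\<close>

type_synonym 'n laurent = "(int ^ 'n) \<Rightarrow>\<^sub>0 complex"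

abbreviation laurent_const :: "complex \<Rightarrow> 'n::finite laurent" where
  "laurent_const c \<equiv> Poly_Mapping.single 0 c"

abbreviation laurent_monom :: "int ^ 'n \<Rightarrow> 'n::finite laurent" where
  "laurent_monom x \<equiv> Poly_Mapping.single x 1"

definition sigma :: "'n \<Rightarrow> 'n::finite laurent" where
  "sigma i = laurent_monom (axis i 1)"

lemma module_laurent_vec: "module ((*s) :: 'n::finite laurent \<Rightarrow> 'n laurent ^ 'k \<Rightarrow> 'n laurent ^ 'k)"
  by unfold_locales (simp_all add: vec_eq_iff algebra_simps)


subsection \<open>Automorphisms\<close>

definition is_laurent_aut :: "('n::finite laurent \<Rightarrow> 'n laurent) \<Rightarrow> bool" where
  "is_laurent_aut \<phi> \<longleftrightarrow> bij \<phi> \<and> (\<forall>p q. \<phi> (p + q) = \<phi> p + \<phi> q) \<and>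
     (\<forall>p q. \<phi> (p * q) = \<phi> p * \<phi> q) \<and> (\<forall>c. \<phi> (laurent_const c) = laurent_const c)"

definition laurent_Aut :: "('n::finite laurent \<Rightarrow> 'n laurent) monoid" where
  "laurent_Aut = \<lparr>carrier = {\<phi>. is_laurent_aut \<phi>}, mult = (\<circ>), one = id\<rparr>"

definition vec_apply :: "('a \<Rightarrow> 'b) \<Rightarrow> 'a ^ 'k \<Rightarrow> 'b ^ 'k" where
  "vec_apply \<phi> v = (\<chi> j. \<phi> (v $ j))"


subsection \<open>Difference operators and solution spaces\<close>

text \<open>The monomial with exponent \<open>y\<close> acts as the shift \<open>f \<mapsto> (\<lambda>x. f (x + y))\<close>, extended linearly.\<close>

definition diff_op :: "'n::finite laurent \<Rightarrow> (int ^ 'n \<Rightarrow> complex) \<Rightarrow> int ^ 'n \<Rightarrow> complex" where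
  "diff_op p f = (\<lambda>x. \<Sum>y\<in>Poly_Mapping.keys p. Poly_Mapping.lookup p y * f (x + y))"

definition solution_space ::
    "('n::finite laurent ^ 'k) set \<Rightarrow> ((int ^ 'n \<Rightarrow> complex) ^ 'k) set" where
  "solution_space P = {f. \<forall>p\<in>P. (\<Sum>j\<in>UNIV. diff_op (p $ j) (f $ j)) = 0}"


subsection \<open>The dual action\<close>

text \<open>The linear functional on A (respectively on its k-th power) that a function on the lattice
  (respectively a k-tuple of functions) is identified with.\<close>

definition pairing :: "(int ^ 'n \<Rightarrow> complex) \<Rightarrow> 'n::finite laurent \<Rightarrow> complex" where
  "pairing f a = (\<Sum>x\<in>Poly_Mapping.keys a. Poly_Mapping.lookup a x * f x)"

definition vec_pairing ::
    "(int ^ 'n \<Rightarrow> complex) ^ 'k \<Rightarrow> 'n::finite laurent ^ 'k \<Rightarrow> complex" where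
  "vec_pairing f q = (\<Sum>j\<in>UNIV. pairing (f $ j) (q $ j))"

text \<open>The action \<open>(g \<cdot> f)(a) = f (g\<^sup>-\<^sup>1 a)\<close> on functionals, read back as a function on the lattice
  by evaluation at the monomials; see \<open>vec_pairing_dual_act\<close> below. Here \<open>inv_into UNIV g\<close> is
  the inverse map of \<open>g\<close>.\<close>

definition dual_act ::
    "('n::finite laurent \<Rightarrow> 'n laurent) \<Rightarrow> (int ^ 'n \<Rightarrow> complex) \<Rightarrow> int ^ 'n \<Rightarrow> complex" where
  "dual_act g f = (\<lambda>x. pairing f (inv_into UNIV g (laurent_monom x)))"

definition symmetric_solutions ::
    "('n::finite laurent \<Rightarrow> 'n laurent) set \<Rightarrow> ('n laurent ^ 'k) set
      \<Rightarrow> ((int ^ 'n \<Rightarrow> complex) ^ 'k) set" where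
  "symmetric_solutions G P = {f \<in> solution_space P. \<forall>g\<in>G. vec_apply (dual_act g) f = f}"


subsection \<open>Consistency of the definitions\<close>

lemma pairing_superset:
  assumes "finite S" "Poly_Mapping.keys a \<subseteq> S"
  shows "pairing f a = (\<Sum>x\<in>S. Poly_Mapping.lookup a x * f x)"
  unfolding pairing_def
  by (rule sum.mono_neutral_left) (use assms in \<open>auto simp: in_keys_iff\<close>)

lemma pairing_add: "pairing f (a + b) = pairing f a + pairing f b"
proof -
  let ?S = "Poly_Mapping.keys a \<union> Poly_Mapping.keys b"
  have "pairing f (a + b) = (\<Sum>x\<in>?S. Poly_Mapping.lookup (a + b) x * f x)"
    by (rule pairing_superset) (use Poly_Mapping.keys_add[of a b] in auto)
  also have "\<dots> = (\<Sum>x\<in>?S. Poly_Mapping.lookup a x * f x) + (\<Sum>x\<in>?S. Poly_Mapping.lookup b x * f x)"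
    by (simp add: lookup_add algebra_simps sum.distrib)
  also have "\<dots> = pairing f a + pairing f b"
    by (subst (1 2) pairing_superset[where S = ?S]) auto
  finally show ?thesis .
qed

lemma pairing_zero [simp]: "pairing f 0 = 0"
  by (simp add: pairing_def)

lemma pairing_single [simp]: "pairing f (Poly_Mapping.single x c) = c * f x"
  by (subst pairing_superset[where S = "{x}"]) auto

lemma pairing_sum: "pairing f (sum h S) = (\<Sum>i\<in>S. pairing f (h i))"
  by (induction S rule: infinite_finite_induct) (auto simp: pairing_add)

lemma laurent_expansion:
  "(p :: 'n::finite laurent) = (\<Sum>y\<in>Poly_Mapping.keys p. Poly_Mapping.single y (Poly_Mapping.lookup p y))"
proof (rule poly_mapping_eqI)
  fix k
  have "Poly_Mapping.lookup (\<Sum>y\<in>Poly_Mapping.keys p. Poly_Mapping.single y (Poly_Mapping.lookup p y)) k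
    = (\<Sum>y\<in>Poly_Mapping.keys p. if y = k then Poly_Mapping.lookup p y else 0)"
    by (auto simp: lookup_sum lookup_single when_def intro!: sum.cong)
  also have "\<dots> = Poly_Mapping.lookup p k"
    by (simp add: sum.delta in_keys_iff)
  finally show "Poly_Mapping.lookup p k = Poly_Mapping.lookup
    (\<Sum>y\<in>Poly_Mapping.keys p. Poly_Mapping.single y (Poly_Mapping.lookup p y)) k" by simp
qed

lemma single_mult_expansion:
  "Poly_Mapping.single x c * p
    = (\<Sum>y\<in>Poly_Mapping.keys p. Poly_Mapping.single (x + y) (c * Poly_Mapping.lookup p y))"
  for p :: "'n::finite laurent"
proof -
  have "Poly_Mapping.single x c * p = Poly_Mapping.single x c *
      (\<Sum>y\<in>Poly_Mapping.keys p. Poly_Mapping.single y (Poly_Mapping.lookup p y))"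
    by (rule arg_cong[OF laurent_expansion])
  then show ?thesis by (simp only: sum_distrib_left mult_single)
qed

lemma pairing_const_mult: "pairing f (laurent_const c * r) = c * pairing f r"
  by (simp add: single_mult_expansion pairing_sum pairing_def[of f r] sum_distrib_left mult.assoc)

lemma diff_op_eq_pairing: "diff_op p f x = pairing f (laurent_monom x * p)"
  by (simp add: single_mult_expansion pairing_sum diff_op_def)

lemma diff_op_sigma: "diff_op (sigma i) f x = f (x + axis i 1)"
  by (simp add: diff_op_eq_pairing sigma_def mult_single)

lemma diff_op_const: "diff_op (laurent_const c) f x = c * f x"
  by (simp add: diff_op_eq_pairing mult_single)

lemma diff_op_add: "diff_op (p + q) f = diff_op p f + diff_op q f"
  by (rule ext) (simp add: diff_op_eq_pairing algebra_simps pairing_add)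

lemma diff_op_mult: "diff_op (p * q) f = diff_op p (diff_op q f)"
proof (rule ext)
  fix x
  have single: "Poly_Mapping.single z c = laurent_const c * laurent_monom z"
    for z :: "int ^ 'a" and c by (simp add: mult_single)
  have "laurent_monom x * (p * q) = (\<Sum>y\<in>Poly_Mapping.keys p.
      Poly_Mapping.single (x + y) (Poly_Mapping.lookup p y)) * q"
    by (simp add: single_mult_expansion[of x 1 p] flip: mult.assoc)
  also have "\<dots> = (\<Sum>y\<in>Poly_Mapping.keys p.
      laurent_const (Poly_Mapping.lookup p y) * (laurent_monom (x + y) * q))"
    unfolding sum_distrib_right
    by (intro sum.cong refl, subst single) (simp only: mult.assoc)
  finally show "diff_op (p * q) f x = diff_op p (diff_op q f) x"
    by (simp only: diff_op_eq_pairing[of "p * q"] pairing_sum diff_op_def[of p]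
      diff_op_eq_pairing[of q] pairing_const_mult)
qed

lemma is_laurent_aut_comp:
  "is_laurent_aut \<phi> \<Longrightarrow> is_laurent_aut \<psi> \<Longrightarrow> is_laurent_aut (\<phi> \<circ> \<psi>)"
  by (auto simp: is_laurent_aut_def intro: bij_comp)

lemma is_laurent_aut_inv:
  assumes "is_laurent_aut \<phi>" shows "is_laurent_aut (inv_into UNIV \<phi>)"
proof -
  have b: "bij \<phi>" using assms by (simp add: is_laurent_aut_def)
  then have s: "\<phi> (inv_into UNIV \<phi> a) = a" "inv_into UNIV \<phi> (\<phi> a) = a" for a
    by (simp_all add: bij_is_surj surj_f_inv_f bij_is_inj)
  have e: "inv_into UNIV \<phi> a = b" if "\<phi> b = a" for a b
    using s that by auto
  show ?thesis
    unfolding is_laurent_aut_def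
    using assms b by (auto simp: is_laurent_aut_def s bij_imp_bij_inv intro!: e)
qed

lemma group_laurent_Aut: "group (laurent_Aut :: ('n::finite laurent \<Rightarrow> 'n laurent) monoid)"
proof (rule groupI)
  fix \<phi> :: "'n laurent \<Rightarrow> 'n laurent" assume "\<phi> \<in> carrier laurent_Aut"
  then have "inv_into UNIV \<phi> \<in> carrier laurent_Aut" "inv_into UNIV \<phi> \<circ> \<phi> = id"
    by (auto simp: laurent_Aut_def is_laurent_aut_inv) (simp add: is_laurent_aut_def bij_is_inj)
  then show "\<exists>\<psi>\<in>carrier laurent_Aut. \<psi> \<otimes>\<^bsub>laurent_Aut\<^esub> \<phi> = \<one>\<^bsub>laurent_Aut\<^esub>"
    by (auto simp: laurent_Aut_def)
qed (auto simp: laurent_Aut_def is_laurent_aut_comp comp_assoc, simp add: is_laurent_aut_def)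

lemma laurent_aut_sum:
  assumes "is_laurent_aut \<phi>" shows "\<phi> (sum h S) = (\<Sum>i\<in>S. \<phi> (h i))"
proof -
  have "\<phi> (0 :: 'a laurent) = 0"
    using assms unfolding is_laurent_aut_def by (metis single_zero)
  then show ?thesis
    using assms by (induction S rule: infinite_finite_induct) (auto simp: is_laurent_aut_def)
qed

lemma pairing_dual_act:
  assumes "is_laurent_aut g"
  shows "pairing (dual_act g f) a = pairing f (inv_into UNIV g a)"
proof -
  let ?h = "inv_into UNIV g"
  note h = is_laurent_aut_inv[OF assms]
  have hs: "?h (Poly_Mapping.single x c) = laurent_const c * ?h (laurent_monom x)" for x c
  proof -
    have "Poly_Mapping.single x c = laurent_const c * laurent_monom x"
      by (simp add: mult_single)
    then show ?thesis using h by (simp add: is_laurent_aut_def)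
  qed
  have "pairing f (?h (Poly_Mapping.single x c)) = c * dual_act g f x" for x c
    unfolding hs[of x c] pairing_const_mult dual_act_def ..
  then have "pairing f (?h (\<Sum>y\<in>Poly_Mapping.keys a. Poly_Mapping.single y (Poly_Mapping.lookup a y)))
      = pairing (dual_act g f) a"
    by (simp add: laurent_aut_sum[OF h] pairing_sum pairing_def[of "dual_act g f"])
  then show ?thesis
    by (simp only: laurent_expansion[of a, symmetric])
qed

lemma sum_fun_apply: "(\<Sum>i\<in>S. h i) x = (\<Sum>i\<in>S. h i x)"
  by (induction S rule: infinite_finite_induct) auto

lemma vec_pairing_dual_act:
  assumes "is_laurent_aut g"
  shows "vec_pairing (vec_apply (dual_act g) f) q = vec_pairing f (vec_apply (inv_into UNIV g) q)"
  by (simp add: vec_pairing_def vec_apply_def pairing_dual_act[OF assms])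

text \<open>Under the identification with functionals, the solutions are exactly the functionals
  vanishing on P.\<close>

lemma solution_space_iff_vec_pairing:
  fixes P :: "('n::finite laurent ^ 'k) set"
  assumes "module.subspace (*s) P"
  shows "f \<in> solution_space P \<longleftrightarrow> (\<forall>p\<in>P. vec_pairing f p = 0)"
proof -
  have *: "(\<Sum>j\<in>UNIV. diff_op (p $ j) (f $ j)) x = vec_pairing f (laurent_monom x *s p)"
    for p :: "'n laurent ^ 'k" and x
  proof -
    have "(\<Sum>j\<in>UNIV. diff_op (p $ j) (f $ j)) x = (\<Sum>j\<in>UNIV. diff_op (p $ j) (f $ j) x)"
      by (rule sum_fun_apply)
    then show ?thesis
      by (simp add: vec_pairing_def diff_op_eq_pairing)
  qed
  have s: "c *s p \<in> P" if "p \<in> P" for c p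
    using assms that by (simp add: module.subspace_def[OF module_laurent_vec])
  have one: "laurent_monom 0 *s p = p" for p :: "'n laurent ^ 'k"
    by (simp add: vec_eq_iff)
  have "f \<in> solution_space P \<longleftrightarrow> (\<forall>p\<in>P. \<forall>x. vec_pairing f (laurent_monom x *s p) = 0)"
    unfolding solution_space_def by (simp only: mem_Collect_eq fun_eq_iff * zero_fun_apply)
  also have "\<dots> \<longleftrightarrow> (\<forall>p\<in>P. vec_pairing f p = 0)"
  proof (intro iffI ballI allI)
    fix p assume "p \<in> P" and "\<forall>p\<in>P. \<forall>x. vec_pairing f (laurent_monom x *s p) = 0"
    then have "vec_pairing f (laurent_monom 0 *s p) = 0" by blast
    then show "vec_pairing f p = 0" by (simp only: one)
  qed (simp add: s)
  finally show ?thesis .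
qed

end

(* Write M for the quotient of A^k by P. Algebra automorphisms fix 1, so the images in M of the
   standard basis vectors are G-invariant, and they generate M; as P is proper, one of them is
   nonzero. A complex linear functional on M with value 1 at this vector keeps that value after
   averaging over G, so its average is a nonzero symmetric solution. *)

theory Submission
  imports Defs
begin

text \<open>The constants act as complex scalars and turn A^k into a complex vector space.
  Automorphisms and functionals are to be linear over these scalars, not over all of A.\<close>

abbreviation const_scale :: "complex \<Rightarrow> 'n::finite laurent ^ 'k \<Rightarrow> 'n laurent ^ 'k" where
  "const_scale c v \<equiv> laurent_const c *s v"

lemma vector_space_const_scale:
  "vector_space (const_scale :: complex \<Rightarrow> 'n::finite laurent ^ 'k \<Rightarrow> _)"
  by unfold_locales (simp_all add: vec_eq_iff algebra_simps single_add mult_single)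

lemma laurent_aut_one: "is_laurent_aut g \<Longrightarrow> g 1 = 1"
  unfolding is_laurent_aut_def by (metis single_one)

lemma laurent_aut_zero: "is_laurent_aut g \<Longrightarrow> g 0 = 0"
  unfolding is_laurent_aut_def by (metis single_zero)

text \<open>With \<open>a = 1\<close> this shows that automorphisms fix the standard basis
  vectors.\<close>

lemma vec_apply_axis: "is_laurent_aut g \<Longrightarrow> vec_apply g (axis j a) = axis j (g a)"
  by (auto simp: vec_apply_def axis_def vec_eq_iff laurent_aut_zero)

lemma linear_vec_apply:
  assumes "is_laurent_aut g"
  shows "Vector_Spaces.linear const_scale const_scale
    (vec_apply g :: 'n::finite laurent ^ 'k \<Rightarrow> 'n laurent ^ 'k)"
  using assms
  by (intro Vector_Spaces.linear_iff[THEN iffD2] conjI vector_space_const_scale)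
     (simp_all add: vec_apply_def vec_eq_iff is_laurent_aut_def)

text \<open>This replaces a functional on the quotient by \<open>S\<close>: a basis of
  \<open>S\<close> stays independent when \<open>v\<close> is added, so the values on it and at
  \<open>v\<close> can be prescribed freely.\<close>

lemma (in vector_space) functional_vanishing_on_subspace:
  assumes "subspace S" "v \<notin> S"
  shows "\<exists>\<phi>. Vector_Spaces.linear scale (*) \<phi> \<and> (\<forall>x\<in>S. \<phi> x = 0) \<and> \<phi> v = 1"
proof -
  interpret F: vector_space "(*) :: 'a \<Rightarrow> 'a \<Rightarrow> 'a"
    by unfold_locales (simp_all add: algebra_simps)
  interpret pair: vector_space_pair scale "(*) :: 'a \<Rightarrow> 'a \<Rightarrow> 'a" ..
  obtain B where B: "B \<subseteq> S" "independent B" "S \<subseteq> span B"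
    by (rule basis_exists)
  have "v \<notin> span B"
    using assms B(1) span_minimal by blast
  then have "independent (insert v B)"
    using B(2) by (rule independent_insertI)
  from pair.linear_independent_extend[OF this, of "\<lambda>x. if x = v then 1 else 0"]
  obtain \<phi> where \<phi>: "Vector_Spaces.linear scale (*) \<phi>"
      "\<forall>x\<in>insert v B. \<phi> x = (if x = v then 1 else 0)"
    by blast
  have "\<phi> x = 0" if "x \<in> S" for x
  proof (rule pair.linear_eq_0_on_span[OF \<phi>(1)])
    show "x \<in> span B" using that B(3) by blast
    show "\<phi> b = 0" if "b \<in> B" for b
      \<comment> \<open>As \<open>b\<close> lies in \<open>S\<close> and \<open>v\<close> does not,
        \<open>b\<close> differs from \<open>v\<close> and gets the value 0.\<close>
      using that \<phi>(2) assms(2) B(1) by auto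
  qed
  then show ?thesis using \<phi> by auto
qed

text \<open>The standard basis vectors generate A^k over A, so a submodule containing all of them is
  everything.\<close>

lemma exists_axis_notin_submodule:
  fixes P :: "('n::finite laurent ^ 'k) set"
  assumes "module.subspace (*s) P" "P \<noteq> UNIV"
  shows "\<exists>j. axis j 1 \<notin> P"
proof (rule ccontr)
  interpret module "(*s) :: 'n laurent \<Rightarrow> 'n laurent ^ 'k \<Rightarrow> 'n laurent ^ 'k"
    by (rule module_laurent_vec)
  assume "\<nexists>j. axis j 1 \<notin> P"
  then have "(\<Sum>j\<in>UNIV. v $ j *s axis j 1) \<in> P" for v
    using assms(1) by (intro subspace_sum subspace_scale) auto
  moreover have "(\<Sum>j\<in>UNIV. v $ j *s axis j 1) = v" for v :: "'n laurent ^ 'k"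
    by (simp add: vec_eq_iff axis_def if_distrib cong: if_cong)
  ultimately show False using assms(2) by auto
qed

text \<open>The inverse of the identification \<open>vec_pairing\<close>: a functional is recorded
  by its values on the monomials in each coordinate.\<close>

definition lattice_function ::
    "('n::finite laurent ^ 'k \<Rightarrow> complex) \<Rightarrow> (int ^ 'n \<Rightarrow> complex) ^ 'k" where
  "lattice_function \<psi> = (\<chi> j. (\<lambda>x. \<psi> (axis j (laurent_monom x))))"

text \<open>Both sides are complex linear in \<open>a\<close> and agree on monomials, which span A
  over the complex numbers.\<close>

lemma pairing_lattice_function:
  assumes "Vector_Spaces.linear const_scale (*) \<psi>"
  shows "pairing (lattice_function \<psi> $ j) a = \<psi> (axis j a)"
proof -
  interpret Vector_Spaces.linear const_scale "(*)" \<psi> by (rule assms)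
  have "axis j a = (\<Sum>x\<in>Poly_Mapping.keys a.
      const_scale (Poly_Mapping.lookup a x) (axis j (laurent_monom x)))"
  proof (rule vec_eq_iff[THEN iffD2], rule allI)
    fix i
    show "axis j a $ i = (\<Sum>x\<in>Poly_Mapping.keys a.
      const_scale (Poly_Mapping.lookup a x) (axis j (laurent_monom x))) $ i"
      using laurent_expansion[of a] by (cases "i = j") (simp_all add: axis_def mult_single)
  qed
  then have "\<psi> (axis j a) = (\<Sum>x\<in>Poly_Mapping.keys a.
      Poly_Mapping.lookup a x * \<psi> (axis j (laurent_monom x)))"
    by (simp only: sum scale)
  then show ?thesis by (simp add: pairing_def lattice_function_def)
qed

lemma vec_pairing_lattice_function:
  assumes "Vector_Spaces.linear const_scale (*) \<psi>"
  shows "vec_pairing (lattice_function \<psi>) q = \<psi> q"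
proof -
  interpret Vector_Spaces.linear const_scale "(*)" \<psi> by (rule assms)
  have "vec_pairing (lattice_function \<psi>) q = \<psi> (\<Sum>j\<in>UNIV. axis j (q $ j))"
    by (simp add: vec_pairing_def pairing_lattice_function[OF assms] sum)
  also have "(\<Sum>j\<in>UNIV. axis j (q $ j)) = q"
    by (simp add: vec_eq_iff axis_def)
  finally show ?thesis .
qed

text \<open>Invariance is assumed for the inverse of \<open>g\<close> because the dual action
  precomposes with that inverse.\<close>

lemma dual_act_lattice_function:
  assumes "Vector_Spaces.linear const_scale (*) \<psi>" "is_laurent_aut g"
    and "\<And>q. \<psi> (vec_apply (inv_into UNIV g) q) = \<psi> q"
  shows "vec_apply (dual_act g) (lattice_function \<psi>) = lattice_function \<psi>"
proof -
  have "dual_act g (lattice_function \<psi> $ j) = lattice_function \<psi> $ j" for j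
  proof
    fix x
    have "dual_act g (lattice_function \<psi> $ j) x
        = \<psi> (vec_apply (inv_into UNIV g) (axis j (laurent_monom x)))"
      unfolding dual_act_def pairing_lattice_function[OF assms(1)]
        vec_apply_axis[OF is_laurent_aut_inv[OF assms(2)]] ..
    then show "dual_act g (lattice_function \<psi> $ j) x = (lattice_function \<psi> $ j) x"
      unfolding assms(3) by (simp add: lattice_function_def)
  qed
  then show ?thesis by (simp add: vec_apply_def vec_eq_iff)
qed

theorem theorem4p1:
  fixes G :: "('n::finite laurent \<Rightarrow> 'n laurent) set"
    and P :: "('n laurent ^ 'k) set"
  assumes "subgroup G laurent_Aut" and "finite G"
    and "module.subspace (*s) P" and "P \<noteq> UNIV"
    and "\<And>g. g \<in> G \<Longrightarrow> vec_apply g ` P = P"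
  shows "\<exists>f \<in> symmetric_solutions G P. f \<noteq> 0"
proof -
  interpret V: vector_space "const_scale :: complex \<Rightarrow> 'n laurent ^ 'k \<Rightarrow> _"
    by (rule vector_space_const_scale)
  interpret G: subgroup G laurent_Aut by (rule assms(1))
  have aut: "is_laurent_aut g" if "g \<in> G" for g
    using G.subset that by (auto simp: laurent_Aut_def)
  have comp: "g \<circ> h \<in> G" if "g \<in> G" "h \<in> G" for g h
    using G.m_closed[OF that] by (simp add: laurent_Aut_def)
  \<comment> \<open>Subgroup closure concerns the inverse in \<open>laurent_Aut\<close>, whereas the
    dual action uses the inverse map; the two are identified here.\<close>
  have inv: "inv_into UNIV g \<in> G" if "g \<in> G" for g
  proof -
    have "inv\<^bsub>laurent_Aut\<^esub> g = inv_into UNIV g"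
      using aut[OF that]
      by (intro group.inv_equality[OF group_laurent_Aut])
         (auto simp: laurent_Aut_def is_laurent_aut_inv, simp add: is_laurent_aut_def bij_is_inj)
    then show ?thesis using G.m_inv_closed[OF that] by simp
  qed
  obtain j where j: "axis j 1 \<notin> P"
    using exists_axis_notin_submodule[OF assms(3,4)] by blast
  \<comment> \<open>Restriction of scalars from A to the constants.\<close>
  have "V.subspace P"
    using assms(3) by (simp add: V.subspace_def module.subspace_def[OF module_laurent_vec])
  from V.functional_vanishing_on_subspace[OF this j]
  obtain \<phi> where \<phi>: "Vector_Spaces.linear const_scale (*) \<phi>"
      "\<forall>p\<in>P. \<phi> p = 0" "\<phi> (axis j 1) = 1"
    by blast
  \<comment> \<open>The average over \<open>G\<close> without the factor 1 / \<open>card G\<close>;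
    its value at \<open>axis j 1\<close> will be \<open>card G\<close> instead of 1.\<close>
  define \<psi> where "\<psi> q = (\<Sum>g\<in>G. \<phi> (vec_apply g q))" for q
  have lin: "Vector_Spaces.linear const_scale (*) \<psi>"
  proof -
    have "Vector_Spaces.linear const_scale (*) (\<phi> \<circ> vec_apply g)" if "g \<in> G" for g
      using linear_vec_apply[OF aut[OF that]] \<phi>(1) by (rule Vector_Spaces.linear_compose)
    then show ?thesis
      unfolding Vector_Spaces.linear_iff \<psi>_def
      using \<phi>(1) by (auto simp: Vector_Spaces.linear_iff sum.distrib sum_distrib_left
        intro!: sum.cong)
  qed
  have invariant: "\<psi> (vec_apply h q) = \<psi> q" if h: "h \<in> G" for h q
  proof -
    have "\<psi> (vec_apply h q) = (\<Sum>g\<in>G. \<phi> (vec_apply (g \<circ> h) q))"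
      by (simp add: \<psi>_def vec_apply_def)
    also have "\<dots> = \<psi> q"
      unfolding \<psi>_def
    \<comment> \<open>Right translation by \<open>h\<close> permutes \<open>G\<close>, with right
      translation by the inverse of \<open>h\<close> undoing it.\<close>
    proof (rule sum.reindex_bij_witness[where i = "\<lambda>g. g \<circ> inv_into UNIV h" and j = "\<lambda>g. g \<circ> h"])
      have *: "h \<circ> inv_into UNIV h = id" "inv_into UNIV h \<circ> h = id"
        using aut[OF h] by (auto simp: is_laurent_aut_def bij_is_inj bij_is_surj surj_iff[symmetric])
      show "(g \<circ> h) \<circ> inv_into UNIV h = g" "(g \<circ> inv_into UNIV h) \<circ> h = g"
        for g :: "'n laurent \<Rightarrow> 'n laurent"
        by (simp_all only: comp_assoc * comp_id)
    qed (use comp h inv in auto)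
    finally show ?thesis .
  qed
  \<comment> \<open>Every \<open>g\<close> in \<open>G\<close> maps \<open>P\<close> into itself,
    where \<phi> vanishes, so each summand is 0.\<close>
  have "\<psi> p = 0" if "p \<in> P" for p
    unfolding \<psi>_def using that assms(5) \<phi>(2) by (auto intro!: sum.neutral)
  then have "lattice_function \<psi> \<in> solution_space P"
    by (simp add: solution_space_iff_vec_pairing[OF assms(3)] vec_pairing_lattice_function[OF lin])
  moreover have "vec_apply (dual_act g) (lattice_function \<psi>) = lattice_function \<psi>" if "g \<in> G" for g
    using dual_act_lattice_function[OF lin aut[OF that]] invariant[OF inv[OF that]] by blast
  moreover have "lattice_function \<psi> \<noteq> 0"
  proof
    assume "lattice_function \<psi> = 0"
    then have "\<psi> (axis j 1) = 0"
      using vec_pairing_lattice_function[OF lin, of "axis j 1"]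
      by (simp add: vec_pairing_def pairing_def)
    \<comment> \<open>Each \<open>g\<close> fixes \<open>axis j 1\<close>, so every summand is 1.
      The count is nonzero since \<open>G\<close> is finite and contains the identity.\<close>
    moreover have "\<psi> (axis j 1) = of_nat (card G)"
      by (simp add: \<psi>_def vec_apply_axis aut laurent_aut_one \<phi>(3))
    ultimately show False
      using assms(2) G.one_closed by auto
  qed
  ultimately show ?thesis by (auto simp: symmetric_solutions_def)
qed

end
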